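(* Let $W_{-k},W_{k+1},G_{k+1},\tilde G_{k+1}\in O_q$ ($k\in\mathbb N$) be the alternating generators of $O_q$, that is, the images of $\mathcal W_{-k},\mathcal W_{k+1},\mathcal G_{k+1},\mathcal{\tilde G}_{k+1}$ under the algebra homomorphism $\gamma:\mathcal O_q\to O_q$. With $\rho=-(q^2-q^{-2})^2$, they satisfy the following relations for all $k,\ell\in\mathbb N$: \begin{align*} &[W_0,W_{k+1}]=[W_{-k},W_1]=(\tilde G_{k+1}-G_{k+1})/(q+q^{-1}),\\ &[W_0,G_{k+1}]_q=[\tilde G_{k+1},W_0]_q=\rho W_{-k-1}-\rho W_{k+1},\\ &[G_{k+1},W_1]_q=[W_1,\tilde G_{k+1}]_q=\rho W_{k+2}-\rho W_{-k},\\ &[W_{-k},W_{-\ell}]=0,\qquad [W_{k+1},W_{\ell+1}]=0,\\ &[W_{-k},W_{\ell+1}]+[W_{k+1},W_{-\ell}]=0,\\ &[W_{-k},G_{\ell+1}]+[G_{k+1},W_{-\ell}]=0,\\ &[W_{-k},\tilde G_{\ell+1}]+[\tilde G_{k+1},W_{-\ell}]=0,\\ &[W_{k+1},G_{\ell+1}]+[G_{k+1},W_{\ell+1}]=0,\\ &[W_{k+1},\tilde G_{\ell+1}]+[\tilde G_{k+1},W_{\ell+1}]=0,\\ &[G_{k+1},G_{\ell+1}]=0,\qquad [\tilde G_{k+1},\tilde G_{\ell+1}]=0,\\ &[\tilde G_{k+1},G_{\ell+1}]+[G_{k+1},\tilde G_{\ell+1}]=0. \end{align*}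
   Context: $\mathbb F$ is a field; $q\in\mathbb F$ is nonzero and not a root of unity; $\mathbb N=\{0,1,2,\ldots\}$; $[n]_q=(q^n-q^{-n})/(q-q^{-1})$. Algebras are associative, unital, over $\mathbb F$. $[X,Y]=XY-YX$ and $[X,Y]_r=rXY-r^{-1}YX$ for nonzero $r \in \mathbb F$. The $q$-Onsager algebra $O_q$ has generators $W_0,W_1$ and relations $[W_0,[W_0,[W_0,W_1]_q]_{q^{-1}}]=(q^2-q^{-2})^2[W_1,W_0]$ and $[W_1,[W_1,[W_1,W_0]_q]_{q^{-1}}]=(q^2-q^{-2})^2[W_0,W_1]$. The algebra $\mathcal O_q$ has generators $\mathcal W_{-k},\mathcal W_{k+1},\mathcal G_{k+1},\mathcal{\tilde G}_{k+1}$ ($k\in\mathbb N$) and, as defining relations, the relations displayed in the claim with each $W_{-k},W_{k+1},G_{k+1},\tilde G_{k+1}$ replaced by the corresponding calligraphic symbol $\mathcal W_{-k},\mathcal W_{k+1},\mathcal G_{k+1},\mathcal{\tilde G}_{k+1}$. Also $\mathcal G_0=\mathcal{\tilde G}_0=-(q-q^{-1})[2]_q^2$. Set $\mathcal W^-(t)=\sum_{n\in\mathbb N}\mathcal W_{-n}t^n$, $\mathcal W^+(t)=\sum_{n\in\mathbb N}\mathcal W_{n+1}t^n$, $\mathcal G(t)=\sum_{n\in\mathbb N}\mathcal G_nt^n$, $\mathcal{\tilde G}(t)=\sum_{n\in\mathbb N}\mathcal{\tilde G}_nt^n$. Let $S=(q+q^{-1})\sum_{\ell\in\mathbb N}(-1)^\ell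 q^{-2\ell-1}t^{2\ell+1}$ (that is, $\frac{q+q^{-1}}{q^{-1}t+qt^{-1}}$) and $T=(q+q^{-1})\sum_{\ell\in\mathbb N}(-1)^\ell q^{2\ell+1}t^{2\ell+1}$ (that is, $\frac{q+q^{-1}}{qt+q^{-1}t^{-1}}$). Define $\Psi(t)=t^{-1}ST\,\mathcal W^-(S)\mathcal W^+(T)+tST\,\mathcal W^+(S)\mathcal W^-(T)-q^2ST\,\mathcal W^-(S)\mathcal W^-(T)-q^{-2}ST\,\mathcal W^+(S)\mathcal W^+(T)+(q^2-q^{-2})^{-2}\mathcal G(S)\mathcal{\tilde G}(T)$ and $\sum_{n\in\mathbb N}\mathcal Z^\vee_nt^n=\mathcal Z^\vee(t)=[2]_q^{-2}\Psi(t)$; one has $\mathcal Z^\vee_0=1$ and each $\mathcal Z^\vee_n$ is central in $\mathcal O_q$. Let $\mathbb F[z_1,z_2,\ldots]$ be the polynomial algebra in countably many commuting variables. Known from earlier work: there is an algebra isomorphism $\phi:O_q\otimes\mathbb F[z_1,z_2,\ldots]\to\mathcal O_q$ that sends $W_0\otimes1\mapsto\mathcal W_0$, $W_1\otimes1\mapsto\mathcal W_1$, $1\otimes z_n\mapsto\mathcal Z^\vee_n$ ($n\ge1$). Let $\theta:\mathbb F[z_1,z_2,\ldots]\to\mathbb F$ be the algebra homomorphism with $z_n\mapsto0$ for $n\ge1$. Then $\gamma:\mathcal O_q\to O_q$ is the algebra homomorphism with $\gamma(\phi(x\otimes f))=\theta(f)x$; equivalently, the algebra homomorphism that sends $\mathcal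 W_0\mapsto W_0$, $\mathcal W_1\mapsto W_1$, $\mathcal Z^\vee_n\mapsto0$ for $n\ge1$. (So the notation $W_0=\gamma(\mathcal W_0)$, $W_1=\gamma(\mathcal W_1)$ is consistent.) *)

theory Defs
  imports
    "HOL-Algebra.QuotRing"
    "HOL-Algebra.Module"
    "HOL-Library.FuncSet"
    "HOL-Library.Poly_Mapping"
    "HOL-Computational_Algebra.Formal_Power_Series"
begin

text \<open>
  The ground field is a type \<open>'a::field\<close>. An associative unital algebra over it is a record of
  type \<open>('a, 'b) module\<close>; the library locale \<open>algebra\<close> is not used, since it demands commutative
  multiplication.
\<close>

section \<open>Algebras, homomorphisms, quotients\<close>

definition alg_hom :: "('a, 'b) module \<Rightarrow> ('a, 'c) module \<Rightarrow> ('b \<Rightarrow> 'c) set" where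
  "alg_hom A B =
     {h \<in> ring_hom A B. \<forall>c. \<forall>x\<in>carrier A. h (c \<odot>\<^bsub>A\<^esub> x) = c \<odot>\<^bsub>B\<^esub> h x}"

definition alg_iso :: "('a, 'b) module \<Rightarrow> ('a, 'c) module \<Rightarrow> ('b \<Rightarrow> 'c) set" where
  "alg_iso A B = {h \<in> alg_hom A B. bij_betw h (carrier A) (carrier B)}"

text \<open>The ring \<open>A Quot I\<close> of the library, equipped with the induced scalar multiplication.\<close>

definition alg_quot :: "('a, 'b) module \<Rightarrow> 'b set \<Rightarrow> ('a, 'b set) module" where
  "alg_quot A I = ring.extend (A Quot I)
     (module.fields (\<lambda>c X. \<Union>x\<in>X. I +>\<^bsub>A\<^esub> (c \<odot>\<^bsub>A\<^esub> x)))"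

definition commutator :: "('a, 'b) module \<Rightarrow> 'b \<Rightarrow> 'b \<Rightarrow> 'b" where
  "commutator A x y = (x \<otimes>\<^bsub>A\<^esub> y) \<ominus>\<^bsub>A\<^esub> (y \<otimes>\<^bsub>A\<^esub> x)"

definition r_commutator :: "('a::field, 'b) module \<Rightarrow> 'a \<Rightarrow> 'b \<Rightarrow> 'b \<Rightarrow> 'b" where
  "r_commutator A r x y =
     (r \<odot>\<^bsub>A\<^esub> (x \<otimes>\<^bsub>A\<^esub> y)) \<ominus>\<^bsub>A\<^esub> (inverse r \<odot>\<^bsub>A\<^esub> (y \<otimes>\<^bsub>A\<^esub> x))"


section \<open>Monoid algebras: free algebras and polynomial algebras\<close>

text \<open>
  For a monoid type \<open>'m\<close> (written additively), \<open>'m \<Rightarrow>\<^sub>0 'a\<close> is the monoid algebra. With \<open>'m\<close> the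
  monoid of words in letters \<open>'x\<close> this is the free algebra on \<open>'x\<close>; with
  \<open>'m = nat \<Rightarrow>\<^sub>0 nat\<close> it is the polynomial algebra in countably many variables.
\<close>

instantiation list :: (type) monoid_add
begin

definition zero_list :: "'a list" where "zero_list = []"
definition plus_list :: "'a list \<Rightarrow> 'a list \<Rightarrow> 'a list" where "plus_list = append"

instance by standard (simp_all add: zero_list_def plus_list_def)

end

definition pscale :: "'a::field \<Rightarrow> ('m \<Rightarrow>\<^sub>0 'a) \<Rightarrow> ('m \<Rightarrow>\<^sub>0 'a)" where
  "pscale c p = Poly_Mapping.map (\<lambda>a. c * a) p"

definition monoid_alg :: "('a::field, 'm::monoid_add \<Rightarrow>\<^sub>0 'a) module" where
  "monoid_alg = \<lparr>carrier = UNIV, monoid.mult = (*), one = 1, ring.zero = 0, add = (+),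
                 smult = pscale\<rparr>"

definition scal :: "'a::field \<Rightarrow> ('m::monoid_add \<Rightarrow>\<^sub>0 'a)" where
  "scal c = Poly_Mapping.single 0 c"

definition gen :: "'x \<Rightarrow> ('x list \<Rightarrow>\<^sub>0 'a::field)" where
  "gen x = Poly_Mapping.single [x] 1"

definition presented_alg :: "('x list \<Rightarrow>\<^sub>0 'a::field) set \<Rightarrow> ('a, ('x list \<Rightarrow>\<^sub>0 'a) set) module" where
  "presented_alg R = alg_quot monoid_alg (Idl\<^bsub>monoid_alg\<^esub> R)"

definition presented_class ::
  "('x list \<Rightarrow>\<^sub>0 'a::field) set \<Rightarrow> ('x list \<Rightarrow>\<^sub>0 'a) \<Rightarrow> ('x list \<Rightarrow>\<^sub>0 'a) set" where
  "presented_class R p = (Idl\<^bsub>monoid_alg\<^esub> R) +>\<^bsub>monoid_alg\<^esub> p"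

text \<open>Commutators of representatives in a free algebra, used to write down relators.\<close>

definition comm :: "('x list \<Rightarrow>\<^sub>0 'a::field) \<Rightarrow> ('x list \<Rightarrow>\<^sub>0 'a) \<Rightarrow> ('x list \<Rightarrow>\<^sub>0 'a)" where
  "comm x y = x * y - y * x"

definition rcomm ::
  "'a::field \<Rightarrow> ('x list \<Rightarrow>\<^sub>0 'a) \<Rightarrow> ('x list \<Rightarrow>\<^sub>0 'a) \<Rightarrow> ('x list \<Rightarrow>\<^sub>0 'a)" where
  "rcomm r x y = pscale r (x * y) - pscale (inverse r) (y * x)"

type_synonym 'a zpoly = "(nat \<Rightarrow>\<^sub>0 nat) \<Rightarrow>\<^sub>0 'a"

text \<open>The variables are \<open>z\<^sub>1, z\<^sub>2, \<dots>\<close>; here \<open>zvar n\<close> stands for \<open>z\<^sub>n\<^sub>+\<^sub>1\<close>.\<close>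

definition zvar :: "nat \<Rightarrow> 'a::field zpoly" where
  "zvar n = Poly_Mapping.single (Poly_Mapping.single n 1) 1"

text \<open>The homomorphism sending every variable to \<open>0\<close>: the constant term.\<close>

definition theta :: "'a::field zpoly \<Rightarrow> 'a" where
  "theta f = Poly_Mapping.lookup f 0"

lemma theta_hom:
  shows "theta (f + g) = theta f + theta g" "theta (f * g) = theta f * theta g"
    and "theta (pscale c f) = c * theta f" "theta 1 = 1" "theta (zvar n) = 0"
proof -
  show "theta (f + g) = theta f + theta g" by (simp add: theta_def lookup_add)
  show "theta (pscale c f) = c * theta f"
    by (simp add: theta_def pscale_def Poly_Mapping.map.rep_eq when_def)
  show "theta 1 = 1" by (simp add: theta_def lookup_one)
  show "theta (zvar n) = 0"
    by (auto simp: theta_def zvar_def lookup_single when_def poly_mapping_eq_iff fun_eq_iff)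
  have sum0: "u + v = 0 \<longleftrightarrow> u = 0 \<and> v = 0" for u v :: "nat \<Rightarrow>\<^sub>0 nat"
    by (auto simp: poly_mapping_eq_iff fun_eq_iff lookup_add)
  have 1: "(\<Sum>v. Poly_Mapping.lookup g v when 0 = u + v) = (Poly_Mapping.lookup g 0 when u = 0)" for u
    using sum0[of u] by (cases "u = 0") (auto simp: when_def intro!: Sum_any.cong)
  show "theta (f * g) = theta f * theta g"
    unfolding theta_def lookup_mult by (subst 1) (simp add: mult_when)
qed


section \<open>Tensor product of algebras\<close>

text \<open>
  As usual: the free vector space on \<open>A \<times> B\<close> modulo the subspace spanned by the bilinearity
  relators, with the multiplication induced by \<open>(x, y) (x', y') = (x x', y y')\<close>.
\<close>

definition pair_alg :: "('a::field, 'b) module \<Rightarrow> ('a, 'c) module \<Rightarrow> ('a, ('b \<times> 'c) \<Rightarrow>\<^sub>0 'a) module" where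
  "pair_alg A B =
     \<lparr>carrier = {p. Poly_Mapping.keys p \<subseteq> carrier A \<times> carrier B},
      monoid.mult = (\<lambda>p r. \<Sum>u\<in>Poly_Mapping.keys p. \<Sum>v\<in>Poly_Mapping.keys r.
         Poly_Mapping.single (fst u \<otimes>\<^bsub>A\<^esub> fst v, snd u \<otimes>\<^bsub>B\<^esub> snd v) (Poly_Mapping.lookup p u * Poly_Mapping.lookup r v)),
      one = Poly_Mapping.single (\<one>\<^bsub>A\<^esub>, \<one>\<^bsub>B\<^esub>) 1,
      ring.zero = 0, add = (+), smult = pscale\<rparr>"

definition bilinear_relators :: "('a::field, 'b) module \<Rightarrow> ('a, 'c) module \<Rightarrow> (('b \<times> 'c) \<Rightarrow>\<^sub>0 'a) set" where
  "bilinear_relators A B =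
     (let e = (\<lambda>x y. Poly_Mapping.single (x, y) (1::'a)) in
      {e (x \<oplus>\<^bsub>A\<^esub> x') y - e x y - e x' y | x x' y. x \<in> carrier A \<and> x' \<in> carrier A \<and> y \<in> carrier B}
    \<union> {e x (y \<oplus>\<^bsub>B\<^esub> y') - e x y - e x y' | x y y'. x \<in> carrier A \<and> y \<in> carrier B \<and> y' \<in> carrier B}
    \<union> {e (c \<odot>\<^bsub>A\<^esub> x) y - pscale c (e x y) | c x y. x \<in> carrier A \<and> y \<in> carrier B}
    \<union> {e x (c \<odot>\<^bsub>B\<^esub> y) - pscale c (e x y) | c x y. x \<in> carrier A \<and> y \<in> carrier B})"

definition tensor_alg ::
  "('a::field, 'b) module \<Rightarrow> ('a, 'c) module \<Rightarrow> ('a, (('b \<times> 'c) \<Rightarrow>\<^sub>0 'a) set) module" where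
  "tensor_alg A B = alg_quot (pair_alg A B) (Modules.module.span pscale (bilinear_relators A B))"

definition pure_tensor ::
  "('a::field, 'b) module \<Rightarrow> ('a, 'c) module \<Rightarrow> 'b \<Rightarrow> 'c \<Rightarrow> (('b \<times> 'c) \<Rightarrow>\<^sub>0 'a) set" where
  "pure_tensor A B x y =
     Modules.module.span pscale (bilinear_relators A B) +>\<^bsub>pair_alg A B\<^esub> Poly_Mapping.single (x, y) 1"


section \<open>The \<open>q\<close>-Onsager algebra\<close>

definition qint :: "'a::field \<Rightarrow> nat \<Rightarrow> 'a" where
  "qint q n = (q ^ n - inverse q ^ n) / (q - inverse q)"

definition rho :: "'a::field \<Rightarrow> 'a" where
  "rho q = - ((q ^ 2 - inverse q ^ 2) ^ 2)"

datatype onsager_gen = W0 | W1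

definition onsager_relators :: "'a::field \<Rightarrow> (onsager_gen list \<Rightarrow>\<^sub>0 'a) set" where
  "onsager_relators q =
    {comm (gen W0) (rcomm (inverse q) (gen W0) (rcomm q (gen W0) (gen W1)))
        - pscale ((q ^ 2 - inverse q ^ 2) ^ 2) (comm (gen W1) (gen W0)),
     comm (gen W1) (rcomm (inverse q) (gen W1) (rcomm q (gen W1) (gen W0)))
        - pscale ((q ^ 2 - inverse q ^ 2) ^ 2) (comm (gen W0) (gen W1))}"

definition Oq :: "'a::field \<Rightarrow> ('a, (onsager_gen list \<Rightarrow>\<^sub>0 'a) set) module" where
  "Oq q = presented_alg (onsager_relators q)"

definition Oq_gen :: "'a::field \<Rightarrow> onsager_gen \<Rightarrow> (onsager_gen list \<Rightarrow>\<^sub>0 'a) set" where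
  "Oq_gen q x = presented_class (onsager_relators q) (gen x)"


section \<open>The alternating central extension\<close>

text \<open>
  For \<open>k \<ge> 0\<close> the letters \<open>Wm k\<close>, \<open>Wp k\<close>, \<open>GG k\<close>, \<open>GT k\<close> stand for the generators with
  subscripts \<open>-k\<close>, \<open>k+1\<close>, \<open>k+1\<close>, \<open>k+1\<close> (script W, script W, script G, script G tilde).
\<close>

datatype alt_gen = Wm nat | Wp nat | GG nat | GT nat

definition alt_relators :: "'a::field \<Rightarrow> (alt_gen list \<Rightarrow>\<^sub>0 'a) set" where
  "alt_relators q =
    (let W = (\<lambda>k. gen (Wm k)); V = (\<lambda>k. gen (Wp k)); G = (\<lambda>k. gen (GG k)); H = (\<lambda>k. gen (GT k)) in
     (\<Union>k. {comm (W 0) (V k) - pscale (inverse (q + inverse q)) (H k - G k),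
           comm (W k) (V 0) - pscale (inverse (q + inverse q)) (H k - G k),
           rcomm q (W 0) (G k) - (pscale (rho q) (W (k + 1)) - pscale (rho q) (V k)),
           rcomm q (H k) (W 0) - (pscale (rho q) (W (k + 1)) - pscale (rho q) (V k)),
           rcomm q (G k) (V 0) - (pscale (rho q) (V (k + 1)) - pscale (rho q) (W k)),
           rcomm q (V 0) (H k) - (pscale (rho q) (V (k + 1)) - pscale (rho q) (W k))})
   \<union> (\<Union>k l. {comm (W k) (W l),
             comm (V k) (V l),
             comm (W k) (V l) + comm (V k) (W l),
             comm (W k) (G l) + comm (G k) (W l),
             comm (W k) (H l) + comm (H k) (W l),
             comm (V k) (G l) + comm (G k) (V l),
             comm (V k) (H l) + comm (H k) (V l),
             comm (G k) (G l),
             comm (H k) (H l),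
             comm (H k) (G l) + comm (G k) (H l)}))"

definition calOq :: "'a::field \<Rightarrow> ('a, (alt_gen list \<Rightarrow>\<^sub>0 'a) set) module" where
  "calOq q = presented_alg (alt_relators q)"

definition calOq_class :: "'a::field \<Rightarrow> (alt_gen list \<Rightarrow>\<^sub>0 'a) \<Rightarrow> (alt_gen list \<Rightarrow>\<^sub>0 'a) set" where
  "calOq_class q p = presented_class (alt_relators q) p"

definition calOq_gen :: "'a::field \<Rightarrow> alt_gen \<Rightarrow> (alt_gen list \<Rightarrow>\<^sub>0 'a) set" where
  "calOq_gen q x = calOq_class q (gen x)"

text \<open>
  The generating functions are written with coefficients in the free algebra, where the library's
  power series over a noncommutative ring apply; the elements of the quotient they define are
  obtained by applying the projection to each coefficient.
\<close>

definition ser_Wm :: "(alt_gen list \<Rightarrow>\<^sub>0 'a::field) fps" where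
  "ser_Wm = Abs_fps (\<lambda>n. gen (Wm n))"

definition ser_Wp :: "(alt_gen list \<Rightarrow>\<^sub>0 'a::field) fps" where
  "ser_Wp = Abs_fps (\<lambda>n. gen (Wp n))"

definition G_zero :: "'a::field \<Rightarrow> 'a" where
  "G_zero q = - ((q - inverse q) * qint q 2 ^ 2)"

definition ser_G :: "'a::field \<Rightarrow> (alt_gen list \<Rightarrow>\<^sub>0 'a) fps" where
  "ser_G q = Abs_fps (\<lambda>n. case n of 0 \<Rightarrow> scal (G_zero q) | Suc k \<Rightarrow> gen (GG k))"

definition ser_Gt :: "'a::field \<Rightarrow> (alt_gen list \<Rightarrow>\<^sub>0 'a) fps" where
  "ser_Gt q = Abs_fps (\<lambda>n. case n of 0 \<Rightarrow> scal (G_zero q) | Suc k \<Rightarrow> gen (GT k))"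

text \<open>Only the coefficients at \<open>n = 2 l + 1\<close> are nonzero, and then \<open>l = n div 2\<close>.\<close>

definition ser_S :: "'a::field \<Rightarrow> (alt_gen list \<Rightarrow>\<^sub>0 'a) fps" where
  "ser_S q = Abs_fps (\<lambda>n. if odd n
     then scal ((q + inverse q) * (- 1) ^ (n div 2) * inverse q ^ n) else 0)"

definition ser_T :: "'a::field \<Rightarrow> (alt_gen list \<Rightarrow>\<^sub>0 'a) fps" where
  "ser_T q = Abs_fps (\<lambda>n. if odd n
     then scal ((q + inverse q) * (- 1) ^ (n div 2) * q ^ n) else 0)"

text \<open>
  The product \<open>S T\<close> is divisible by \<open>t\<^sup>2\<close>, so the shift below is multiplication by \<open>t\<^sup>-\<^sup>1\<close>.
\<close>

definition Psi :: "'a::field \<Rightarrow> (alt_gen list \<Rightarrow>\<^sub>0 'a) fps" where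
  "Psi q =
    (let S = ser_S q; T = ser_T q; sc = (\<lambda>c. fps_const (scal c)) in
       fps_shift 1 (S * T) * (ser_Wm oo S) * (ser_Wp oo T)
     + fps_X * S * T * (ser_Wp oo S) * (ser_Wm oo T)
     - sc (q ^ 2) * S * T * (ser_Wm oo S) * (ser_Wm oo T)
     - sc (inverse q ^ 2) * S * T * (ser_Wp oo S) * (ser_Wp oo T)
     + sc (inverse ((q ^ 2 - inverse q ^ 2) ^ 2)) * (ser_G q oo S) * (ser_Gt q oo T))"

definition Zvee :: "'a::field \<Rightarrow> nat \<Rightarrow> (alt_gen list \<Rightarrow>\<^sub>0 'a) set" where
  "Zvee q n = calOq_class q (pscale (inverse (qint q 2 ^ 2)) (fps_nth (Psi q) n))"


section \<open>The isomorphism and the projection onto \<open>O\<^sub>q\<close>\<close>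

definition OqZ ::
  "'a::field \<Rightarrow> ('a, (((onsager_gen list \<Rightarrow>\<^sub>0 'a) set \<times> 'a zpoly) \<Rightarrow>\<^sub>0 'a) set) module" where
  "OqZ q = tensor_alg (Oq q) monoid_alg"

definition OqZ_pure ::
  "'a::field \<Rightarrow> (onsager_gen list \<Rightarrow>\<^sub>0 'a) set \<Rightarrow> 'a zpoly
     \<Rightarrow> (((onsager_gen list \<Rightarrow>\<^sub>0 'a) set \<times> 'a zpoly) \<Rightarrow>\<^sub>0 'a) set" where
  "OqZ_pure q x f = pure_tensor (Oq q) monoid_alg x f"

definition is_phi ::
  "'a::field \<Rightarrow> ((((onsager_gen list \<Rightarrow>\<^sub>0 'a) set \<times> 'a zpoly) \<Rightarrow>\<^sub>0 'a) set
     \<Rightarrow> (alt_gen list \<Rightarrow>\<^sub>0 'a) set) \<Rightarrow> bool" where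
  "is_phi q \<phi> \<longleftrightarrow>
     \<phi> \<in> alg_iso (OqZ q) (calOq q)
   \<and> \<phi> (OqZ_pure q (Oq_gen q W0) 1) = calOq_gen q (Wm 0)
   \<and> \<phi> (OqZ_pure q (Oq_gen q W1) 1) = calOq_gen q (Wp 0)
   \<and> (\<forall>n. \<phi> (OqZ_pure q \<one>\<^bsub>Oq q\<^esub> (zvar n)) = Zvee q (n + 1))"

text \<open>
  Extensionality fixes the irrelevant values outside the carrier, so that the description is unique.
\<close>

definition gamma ::
  "'a::field \<Rightarrow> ((((onsager_gen list \<Rightarrow>\<^sub>0 'a) set \<times> 'a zpoly) \<Rightarrow>\<^sub>0 'a) set
     \<Rightarrow> (alt_gen list \<Rightarrow>\<^sub>0 'a) set)
     \<Rightarrow> (alt_gen list \<Rightarrow>\<^sub>0 'a) set \<Rightarrow> (onsager_gen list \<Rightarrow>\<^sub>0 'a) set" where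
  "gamma q \<phi> = (THE g.
     g \<in> alg_hom (calOq q) (Oq q) \<and> g \<in> extensional (carrier (calOq q))
   \<and> (\<forall>x\<in>carrier (Oq q). \<forall>f. g (\<phi> (OqZ_pure q x f)) = theta f \<odot>\<^bsub>Oq q\<^esub> x))"

end

(*
  The relations hold in the alternating central extension by construction, so it is enough that
  gamma is an algebra homomorphism. It is the composite of the inverse of phi with the map
  x (x) f |-> theta(f) x, which exists by the universal property of the tensor product; it is unique
  because pure tensors span.
*)

theory Submission
  imports Defs "HOL-Algebra.Multiplicative_Group"
begin

section \<open>Unital algebras and their quotients\<close>

text \<open>Since \<open>gamma\<close> is a definite description, not even its additivity is
  available before existence and uniqueness are settled. Most of the work thus goes into the tensor
  product. It divides formal combinations of pairs by a linear span, and the quotient is an algebra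
  only if that span is a two-sided ideal, so absorption of products must be proved. Presented
  algebras need the same quotient step, which is therefore developed once, for noncommutative
  algebras given as records.

  The map sending a pure tensor of x and f to theta(f) x is assembled from the identity and f |->
  theta(f) 1. Their images commute because multiples of the unit are central.

  The defining relations live in the free algebra. Composing \<open>gamma\<close> with the
  projection gives a homomorphism out of the free algebra that kills every relator, and evaluating
  it on the relators gives the relations claimed.\<close>

locale unital_algebra = ring A for A :: "('a::field, 'b) module" (structure) +
  assumes smult_closed [simp, intro]: "x \<in> carrier A \<Longrightarrow> c \<odot> x \<in> carrier A"
    and smult_add_left: "x \<in> carrier A \<Longrightarrow> (c + d) \<odot> x = c \<odot> x \<oplus> d \<odot> x"
    and smult_add_right: "x \<in> carrier A \<Longrightarrow> y \<in> carrier A \<Longrightarrow> c \<odot> (x \<oplus> y) = c \<odot> x \<oplus> c \<odot> y"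
    and smult_smult: "x \<in> carrier A \<Longrightarrow> c \<odot> (d \<odot> x) = (c * d) \<odot> x"
    and smult_one: "x \<in> carrier A \<Longrightarrow> 1 \<odot> x = x"
    and smult_mult_left: "x \<in> carrier A \<Longrightarrow> y \<in> carrier A \<Longrightarrow> (c \<odot> x) \<otimes> y = c \<odot> (x \<otimes> y)"
    and smult_mult_right: "x \<in> carrier A \<Longrightarrow> y \<in> carrier A \<Longrightarrow> x \<otimes> (c \<odot> y) = c \<odot> (x \<otimes> y)"
begin

lemma smult_zero_left: "x \<in> carrier A \<Longrightarrow> 0 \<odot> x = \<zero>"
  using smult_add_left[of x 0 0] by (metis add.r_cancel_one' add_0 smult_closed)

lemma smult_zero_right: "c \<odot> \<zero> = \<zero>"
  by (metis mult_zero_right smult_smult smult_zero_left zero_closed)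

lemma smult_minus_one: "x \<in> carrier A \<Longrightarrow> (- 1) \<odot> x = \<ominus> x"
  using smult_add_left[of x "- 1" 1]
  by (intro minus_equality[symmetric]) (simp_all add: smult_one smult_zero_left)

text \<open>Closure of a ring ideal under scalars comes from the unit: c x = (c 1) x is a product
  with a ring element.\<close>

lemma ideal_smult_closed:
  assumes "ideal I A" "x \<in> I"
  shows "c \<odot> x \<in> I"
proof -
  interpret ideal I A by fact
  have "(c \<odot> \<one>) \<otimes> x \<in> I" using assms(2) by (intro I_l_closed) auto
  then show ?thesis using assms(2) by (simp add: smult_mult_left a_Hcarr)
qed

end

text \<open>Carries \<open>quotient_is_ring\<close> over to \<open>alg_quot\<close>: the extended
  record has the same ring operations but another type, so the axioms are checked again.\<close>

lemma ring_extend: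
  assumes "ring R"
  shows "ring (ring.extend R m)"
proof -
  interpret ring R by fact
  show ?thesis
    unfolding ring.extend_def
    by (intro ringI abelian_groupI monoidI)
      (auto simp: m_assoc l_distr r_distr a_ac intro: add.l_inv_ex)
qed

lemma alg_quot_simps:
  "carrier (alg_quot A I) = a_rcosets\<^bsub>A\<^esub> I"
  "monoid.mult (alg_quot A I) = rcoset_mult A I"
  "monoid.one (alg_quot A I) = I +>\<^bsub>A\<^esub> \<one>\<^bsub>A\<^esub>"
  "ring.zero (alg_quot A I) = I"
  "ring.add (alg_quot A I) = set_add A"
  "module.smult (alg_quot A I) = (\<lambda>c X. \<Union>x\<in>X. I +>\<^bsub>A\<^esub> (c \<odot>\<^bsub>A\<^esub> x))"
  by (simp_all add: alg_quot_def ring.extend_def module.fields_def FactRing_def)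

locale algebra_ideal = unital_algebra A + ideal I A for A (structure) and I
begin

abbreviation proj where "proj x \<equiv> I +> x"

lemma proj_eq_iff: "x \<in> carrier A \<Longrightarrow> y \<in> carrier A \<Longrightarrow> proj x = proj y \<longleftrightarrow> x \<ominus> y \<in> I"
  using quotient_eq_iff_same_a_r_cos[OF is_ideal] by blast

text \<open>The union in \<open>alg_quot\<close> runs over all representatives of a coset. Two of
  them differ by some i in \<open>I\<close>, and c i lies in \<open>I\<close> again, so a nonempty
  family of equal cosets is united.\<close>

lemma proj_smult:
  assumes "x \<in> carrier A"
  shows "c \<odot>\<^bsub>alg_quot A I\<^esub> proj x = proj (c \<odot> x)"
proof -
  have "proj (c \<odot> y) = proj (c \<odot> x)" if "y \<in> proj x" for y
  proof -
    obtain i where i: "i \<in> I" "y = i \<oplus> x" using \<open>y \<in> proj x\<close> by (auto simp: a_r_coset_def')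
    have "c \<odot> y \<ominus> c \<odot> x = c \<odot> i"
      using i assms by (simp add: smult_add_right a_Hcarr minus_eq a_assoc r_neg)
    then show ?thesis
      using i assms ideal_smult_closed[OF is_ideal] by (simp add: proj_eq_iff a_Hcarr)
  qed
  moreover have "x \<in> proj x" using a_rcos_self[OF assms] .
  ultimately show ?thesis unfolding alg_quot_simps by (intro SUP_eq_const) blast+
qed

lemma proj_alg_hom: "proj \<in> alg_hom A (alg_quot A I)"
  unfolding alg_hom_def
proof (intro CollectI conjI allI ballI ring_hom_memI)
  show "proj x \<in> carrier (alg_quot A I)" if "x \<in> carrier A" for x
    using that a_rcosetsI[OF a_subset] by (simp add: alg_quot_simps(1))
  show "proj (x \<otimes> y) = proj x \<otimes>\<^bsub>alg_quot A I\<^esub> proj y"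
    "proj (x \<oplus> y) = proj x \<oplus>\<^bsub>alg_quot A I\<^esub> proj y" if "x \<in> carrier A" "y \<in> carrier A" for x y
    using that by (simp_all add: alg_quot_simps(2,5) rcoset_mult_add a_rcos_sum)
qed (simp_all add: alg_quot_simps(3) proj_smult)

lemma quot_cases:
  assumes "X \<in> carrier (alg_quot A I)"
  obtains x where "x \<in> carrier A" "X = proj x"
  using assms by (auto simp: alg_quot_simps A_RCOSETS_def')

lemma unital_algebra_quot: "unital_algebra (alg_quot A I)"
proof -
  have r: "ring (alg_quot A I)"
    unfolding alg_quot_def by (intro ring_extend quotient_is_ring)
  have "proj x \<in> carrier (alg_quot A I)" "proj x \<oplus>\<^bsub>alg_quot A I\<^esub> proj y = proj (x \<oplus> y)"
    "proj x \<otimes>\<^bsub>alg_quot A I\<^esub> proj y = proj (x \<otimes> y)"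
    if "x \<in> carrier A" "y \<in> carrier A" for x y
    using proj_alg_hom that by (auto simp: alg_hom_def ring_hom_def)
  note * = this
  show ?thesis
    by (intro unital_algebra.intro r unital_algebra_axioms.intro; elim quot_cases)
      (simp_all add: *(2,3) *(1)[of _ "\<one>"] proj_smult smult_add_left smult_add_right smult_smult smult_one
        smult_mult_left smult_mult_right)
qed

lemma quot_lift:
  assumes C: "unital_algebra C" and h: "h \<in> alg_hom A C"
    and ker: "\<And>x. x \<in> I \<Longrightarrow> h x = \<zero>\<^bsub>C\<^esub>"
  obtains g where "g \<in> alg_hom (alg_quot A I) C" "\<And>x. x \<in> carrier A \<Longrightarrow> g (proj x) = h x"
proof -
  interpret C: unital_algebra C by fact
  interpret h: ring_hom_ring A C h
    using h by (intro ring_hom_ringI2) (auto simp: alg_hom_def ring_axioms C.ring_axioms)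
  \<comment> \<open>\<open>h\<close> is evaluated at a chosen representative; the choice does not
    matter, because \<open>h\<close> vanishes on differences of representatives.\<close>
  define g where "g X = h (SOME x. x \<in> carrier A \<and> X = proj x)" for X
  have g: "g (proj x) = h x" if x: "x \<in> carrier A" for x
  proof -
    define y where "y = (SOME y. y \<in> carrier A \<and> proj x = proj y)"
    have y: "y \<in> carrier A" "proj x = proj y"
      using someI[of "\<lambda>y. y \<in> carrier A \<and> proj x = proj y" x] x by (auto simp: y_def)
    then have "h (y \<ominus> x) = \<zero>\<^bsub>C\<^esub>" using x by (intro ker) (simp flip: proj_eq_iff)
    then have "h y = h x" using x y(1) by (simp add: minus_eq flip: C.minus_eq)
    then show ?thesis by (simp add: g_def y_def)
  qed
  have sums: "proj x \<oplus>\<^bsub>alg_quot A I\<^esub> proj y = proj (x \<oplus> y)"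
    "proj x \<otimes>\<^bsub>alg_quot A I\<^esub> proj y = proj (x \<otimes> y)" "\<one>\<^bsub>alg_quot A I\<^esub> = proj \<one>"
    if "x \<in> carrier A" "y \<in> carrier A" for x y
    using proj_alg_hom that by (auto simp: alg_hom_def ring_hom_def)
  have smult: "h (c \<odot> x) = c \<odot>\<^bsub>C\<^esub> h x" if "x \<in> carrier A" for c x
    using h that by (simp add: alg_hom_def)
  have "g \<in> ring_hom (alg_quot A I) C"
    by (rule ring_hom_memI; (elim quot_cases)?)
      (simp_all add: sums(1,2) sums(3)[OF one_closed one_closed] g)
  moreover have "g (c \<odot>\<^bsub>alg_quot A I\<^esub> X) = c \<odot>\<^bsub>C\<^esub> g X" if "X \<in> carrier (alg_quot A I)" for c X
    using that by (elim quot_cases) (simp add: proj_smult g smult)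
  ultimately have "g \<in> alg_hom (alg_quot A I) C" by (simp add: alg_hom_def)
  with g that show thesis by blast
qed

end

section \<open>Monoid algebras and presented algebras\<close>

lemma lookup_pscale [simp]: "Poly_Mapping.lookup (pscale c p) k = c * Poly_Mapping.lookup p k"
  by (simp add: pscale_def Poly_Mapping.map.rep_eq when_def)

lemma pscale_single [simp]: "pscale c (Poly_Mapping.single k d) = Poly_Mapping.single k (c * d)"
  by (rule poly_mapping_eqI) (simp add: lookup_single when_def)

lemma module_pscale: "Modules.module pscale"
  by unfold_locales (auto intro!: poly_mapping_eqI simp: lookup_add algebra_simps)

interpretation pscale: Modules.module pscale
  by (rule module_pscale)

lemma keys_pscale: "Poly_Mapping.keys (pscale c p) \<subseteq> Poly_Mapping.keys p"
  by (auto simp: in_keys_iff)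

text \<open>Reduces additive statements to monomials supported in \<open>D\<close>. The coefficient
  in \<open>single\<close> may be zero, which is how \<open>P 0\<close> is obtained, and this takes
  some key in \<open>D\<close>.\<close>

lemma poly_mapping_on_induct [consumes 1, case_names single add]:
  assumes "Poly_Mapping.keys p \<subseteq> D"
    and single: "\<And>k c. k \<in> D \<Longrightarrow> P (Poly_Mapping.single k c)"
    and add: "\<And>p r. Poly_Mapping.keys p \<subseteq> D \<Longrightarrow> Poly_Mapping.keys r \<subseteq> D \<Longrightarrow> P p \<Longrightarrow> P r \<Longrightarrow> P (p + r)"
    and "D \<noteq> {}"
  shows "P p"
proof -
  have zero: "P 0" using single[of _ 0] \<open>D \<noteq> {}\<close> by auto
  have "Poly_Mapping.keys p \<subseteq> D \<longrightarrow> P p"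
  proof (induction p rule: update_induct)
    case const
    with zero show ?case by simp
  next
    case (update p k c)
    \<comment> \<open>Updating at a key outside the support amounts to adding a monomial.\<close>
    have eq: "Poly_Mapping.update k c p = Poly_Mapping.single k c + p"
      using update by (intro poly_mapping_eqI) (auto simp: lookup_update lookup_add lookup_single in_keys_iff)
    show ?case
      using update add[of "Poly_Mapping.single k c" p] single[of k c]
      by (auto simp: eq keys_update simp flip: eq)
  qed
  with assms(1) show ?thesis by blast
qed

lemma pscale_mult_left: "pscale c p * r = pscale c (p * r)"
  for p :: "'m::monoid_add \<Rightarrow>\<^sub>0 'a::field"
  by (simp add: pscale_def mult_map_scale_conv_mult mult.assoc)

text \<open>Scaling is multiplication by the monomial at the unit \<open>0\<close> of the monoid.
  That monomial is central even if the monoid is not commutative, so the scalar may be moved past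
  \<open>p\<close>.\<close>

lemma pscale_mult_right: "p * pscale c r = pscale c (p * r)"
  for p :: "'m::monoid_add \<Rightarrow>\<^sub>0 'a::field"
proof -
  have comm: "p * Poly_Mapping.single 0 c = Poly_Mapping.single 0 c * p" for p :: "'m \<Rightarrow>\<^sub>0 'a"
    by (rule poly_mapping_on_induct[of p UNIV])
      (simp_all add: mult_single distrib_left distrib_right mult.commute)
  show ?thesis
    using comm[of p] by (simp add: pscale_def mult_map_scale_conv_mult flip: mult.assoc)
qed

lemma monoid_alg_simps [simp]:
  "carrier monoid_alg = UNIV"
  "monoid.mult monoid_alg = (*)"
  "\<one>\<^bsub>monoid_alg\<^esub> = 1"
  "\<zero>\<^bsub>monoid_alg\<^esub> = 0"
  "ring.add monoid_alg = (+)"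
  "module.smult monoid_alg = pscale"
  by (simp_all add: monoid_alg_def)

lemma unital_algebra_monoid_alg: "unital_algebra (monoid_alg :: ('a::field, 'm::monoid_add \<Rightarrow>\<^sub>0 'a) module)"
proof -
  have "ring (monoid_alg :: ('a, 'm \<Rightarrow>\<^sub>0 'a) module)"
  proof (intro ringI abelian_groupI monoidI)
    show "\<exists>y\<in>carrier monoid_alg. y \<oplus>\<^bsub>monoid_alg\<^esub> x = \<zero>\<^bsub>monoid_alg\<^esub>" for x :: "'m \<Rightarrow>\<^sub>0 'a"
      by (intro bexI[of _ "- x"]) simp_all
  qed (simp_all add: mult.assoc distrib_left distrib_right add_ac)
  then show ?thesis
    by (intro unital_algebra.intro unital_algebra_axioms.intro)
      (simp_all add: pscale.scale_left_distrib pscale.scale_right_distrib pscale_mult_left pscale_mult_right)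
qed

lemma algebra_ideal_presented:
  "algebra_ideal monoid_alg (Idl\<^bsub>monoid_alg :: ('a::field, 'm::monoid_add \<Rightarrow>\<^sub>0 'a) module\<^esub> R)"
  using unital_algebra.axioms(1)[OF unital_algebra_monoid_alg]
  by (intro algebra_ideal.intro unital_algebra_monoid_alg ring.genideal_ideal) simp_all

lemma unital_algebra_presented: "unital_algebra (presented_alg R)"
  using algebra_ideal.unital_algebra_quot[OF algebra_ideal_presented]
  by (simp add: presented_alg_def)

lemma presented_class_alg_hom: "presented_class R \<in> alg_hom monoid_alg (presented_alg R)"
  using algebra_ideal.proj_alg_hom[OF algebra_ideal_presented]
  by (simp add: presented_alg_def presented_class_def[abs_def])

lemma presented_class_relator:
  assumes "r \<in> R"
  shows "presented_class R r = \<zero>\<^bsub>presented_alg R\<^esub>"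
proof -
  interpret algebra_ideal monoid_alg "Idl\<^bsub>monoid_alg\<^esub> R"
    by (rule algebra_ideal_presented)
  have "r \<in> Idl\<^bsub>monoid_alg\<^esub> R" using assms genideal_self[of R] by auto
  then show ?thesis by (simp add: presented_alg_def presented_class_def alg_quot_simps(4) a_rcos_const)
qed

section \<open>Tensor products\<close>

lemma pair_alg_simps [simp]:
  "carrier (pair_alg A B) = {p. Poly_Mapping.keys p \<subseteq> carrier A \<times> carrier B}"
  "\<one>\<^bsub>pair_alg A B\<^esub> = Poly_Mapping.single (\<one>\<^bsub>A\<^esub>, \<one>\<^bsub>B\<^esub>) 1"
  "\<zero>\<^bsub>pair_alg A B\<^esub> = 0"
  "ring.add (pair_alg A B) = (+)"
  "module.smult (pair_alg A B) = pscale"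
  by (simp_all add: pair_alg_def)

text \<open>The product sums over supports, and cancellation can make the support of
  \<open>p + p'\<close> smaller than the union. Terms with coefficient zero contribute nothing, so
  the sums still split.\<close>

lemma pair_mult_add_left:
  "(p + p') \<otimes>\<^bsub>pair_alg A B\<^esub> r = p \<otimes>\<^bsub>pair_alg A B\<^esub> r + p' \<otimes>\<^bsub>pair_alg A B\<^esub> r"
  unfolding pair_alg_def monoid.simps
  by (rule setsum_keys_plus_distrib) (simp_all add: distrib_right single_add sum.distrib)

lemma pair_mult_add_right:
  "p \<otimes>\<^bsub>pair_alg A B\<^esub> (r + r') = p \<otimes>\<^bsub>pair_alg A B\<^esub> r + p \<otimes>\<^bsub>pair_alg A B\<^esub> r'"
  unfolding pair_alg_def monoid.simps sum.distrib[symmetric]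
  by (rule sum.cong[OF refl], rule setsum_keys_plus_distrib) (simp_all add: distrib_left single_add)

lemma pair_mult_single [simp]:
  "Poly_Mapping.single u c \<otimes>\<^bsub>pair_alg A B\<^esub> Poly_Mapping.single v d =
     Poly_Mapping.single (fst u \<otimes>\<^bsub>A\<^esub> fst v, snd u \<otimes>\<^bsub>B\<^esub> snd v) (c * d)"
  by (auto simp: pair_alg_def lookup_single)

lemma pair_mult_diff_left:
  "(p - p') \<otimes>\<^bsub>pair_alg A B\<^esub> r = p \<otimes>\<^bsub>pair_alg A B\<^esub> r - p' \<otimes>\<^bsub>pair_alg A B\<^esub> r"
  using pair_mult_add_left[where p="p - p'" and p'=p'] by simp

lemma pair_mult_diff_right:
  "p \<otimes>\<^bsub>pair_alg A B\<^esub> (r - r') = p \<otimes>\<^bsub>pair_alg A B\<^esub> r - p \<otimes>\<^bsub>pair_alg A B\<^esub> r'"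
  using pair_mult_add_right[where r="r - r'" and r'=r'] by simp

locale tensor_product = A: unital_algebra A + B: unital_algebra B
  for A :: "('a::field, 'b) module" and B :: "('a, 'c) module"
begin

abbreviation P where "P \<equiv> pair_alg A B"
abbreviation N where "N \<equiv> Modules.module.span pscale (bilinear_relators A B)"

lemma carrier_induct [consumes 1, case_names single add]:
  assumes "p \<in> carrier P"
    and "\<And>x y c. x \<in> carrier A \<Longrightarrow> y \<in> carrier B \<Longrightarrow> Q (Poly_Mapping.single (x, y) c)"
    and "\<And>p r. p \<in> carrier P \<Longrightarrow> r \<in> carrier P \<Longrightarrow> Q p \<Longrightarrow> Q r \<Longrightarrow> Q (p + r)"
  shows "Q p"
proof -
  have "carrier A \<times> carrier B \<noteq> {}" using A.zero_closed B.zero_closed by blast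
  then show ?thesis
    using assms by (intro poly_mapping_on_induct[of p "carrier A \<times> carrier B" Q]) auto
qed

lemma add_closed: "p \<in> carrier P \<Longrightarrow> r \<in> carrier P \<Longrightarrow> p + r \<in> carrier P"
  using keys_add[of p r] by auto

lemma single_closed:
  "x \<in> carrier A \<Longrightarrow> y \<in> carrier B \<Longrightarrow> Poly_Mapping.single (x, y) c \<in> carrier P"
  by simp

lemma mult_closed: "p \<in> carrier P \<Longrightarrow> r \<in> carrier P \<Longrightarrow> p \<otimes>\<^bsub>P\<^esub> r \<in> carrier P"
proof (induction p rule: carrier_induct)
  case (single x y c)
  from single(3) show ?case
  proof (induction r rule: carrier_induct)
    case (single x' y' c')
    with \<open>x \<in> carrier A\<close> \<open>y \<in> carrier B\<close> show ?case
      unfolding pair_mult_single by (intro single_closed) auto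
  qed (simp only: pair_mult_add_right add_closed)
qed (simp only: pair_mult_add_left add_closed)

text \<open>Both sides are additive in each argument, so three nested inductions leave only
  monomials. There the claim is associativity in \<open>A\<close> and \<open>B\<close>, which holds
  on the carriers only.\<close>

lemma mult_assoc:
  assumes "p \<in> carrier P" "r \<in> carrier P" "s \<in> carrier P"
  shows "(p \<otimes>\<^bsub>P\<^esub> r) \<otimes>\<^bsub>P\<^esub> s = p \<otimes>\<^bsub>P\<^esub> (r \<otimes>\<^bsub>P\<^esub> s)"
  using assms(1)
proof (induction p rule: carrier_induct)
  case p: (single x y c)
  from assms(2) show ?case
  proof (induction r rule: carrier_induct)
    case r: (single x' y' c')
    from assms(3) show ?case
      by (induction s rule: carrier_induct)
        (use p r in \<open>simp_all add: pair_mult_add_right A.m_assoc B.m_assoc mult.assoc\<close>)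
  qed (simp only: pair_mult_add_left pair_mult_add_right)
qed (simp only: pair_mult_add_left)

lemma one_mult: "p \<in> carrier P \<Longrightarrow> \<one>\<^bsub>P\<^esub> \<otimes>\<^bsub>P\<^esub> p = p"
  by (induction p rule: carrier_induct) (simp_all add: pair_mult_add_right)

lemma mult_one: "p \<in> carrier P \<Longrightarrow> p \<otimes>\<^bsub>P\<^esub> \<one>\<^bsub>P\<^esub> = p"
  by (induction p rule: carrier_induct) (simp_all add: pair_mult_add_left)

lemma pscale_mult:
  assumes "p \<in> carrier P" "r \<in> carrier P"
  shows "pscale c p \<otimes>\<^bsub>P\<^esub> r = pscale c (p \<otimes>\<^bsub>P\<^esub> r)"
    and "p \<otimes>\<^bsub>P\<^esub> pscale c r = pscale c (p \<otimes>\<^bsub>P\<^esub> r)"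
proof -
  have *: "pscale c p \<otimes>\<^bsub>P\<^esub> r = pscale c (p \<otimes>\<^bsub>P\<^esub> r) \<and> p \<otimes>\<^bsub>P\<^esub> pscale c r = pscale c (p \<otimes>\<^bsub>P\<^esub> r)"
    using assms(1)
  proof (induction p rule: carrier_induct)
    case p: (single x y d)
    from assms(2) show ?case
      by (induction r rule: carrier_induct)
        (use p in \<open>simp_all add: pair_mult_add_right pscale.scale_right_distrib mult_ac\<close>)
  qed (simp only: pair_mult_add_left pscale.scale_right_distrib)
  show "pscale c p \<otimes>\<^bsub>P\<^esub> r = pscale c (p \<otimes>\<^bsub>P\<^esub> r)" "p \<otimes>\<^bsub>P\<^esub> pscale c r = pscale c (p \<otimes>\<^bsub>P\<^esub> r)"
    using * by auto
qed

lemma pscale_closed: "p \<in> carrier P \<Longrightarrow> pscale c p \<in> carrier P"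
  using keys_pscale[of c p] by auto

lemma unital_algebra_pair: "unital_algebra P"
proof -
  have "ring P"
  proof (intro ringI abelian_groupI monoidI)
    show "\<exists>r\<in>carrier P. r \<oplus>\<^bsub>P\<^esub> p = \<zero>\<^bsub>P\<^esub>" if "p \<in> carrier P" for p
      using that by (intro bexI[of _ "- p"]) auto
  qed (use add_closed mult_closed in
      \<open>simp_all add: mult_assoc one_mult[simplified] mult_one[simplified] pair_mult_add_left
        pair_mult_add_right add_ac\<close>)
  then show ?thesis
    by (intro unital_algebra.intro unital_algebra_axioms.intro)
      (simp_all add: pscale_mult pscale_closed pscale.scale_left_distrib
        pscale.scale_right_distrib del: pair_alg_simps(1))
qed

lemma relators_closed: "bilinear_relators A B \<subseteq> carrier P"
proof -
  have diff: "p - r \<in> carrier P" if "p \<in> carrier P" "r \<in> carrier P" for p r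
    using add_closed[OF that(1) pscale_closed[OF that(2)], of "- 1"] by simp
  show ?thesis
    unfolding bilinear_relators_def Let_def
    by (auto intro!: diff single_closed simp del: pair_alg_simps)
qed

lemma span_closed: "N \<subseteq> carrier P"
  by (intro pscale.span_minimal relators_closed pscale.subspaceI add_closed pscale_closed) auto

text \<open>Multiplying a relator by a monomial with coefficient d gives d times a relator of the
  same kind. These are the shapes that arise in \<open>relator_mult\<close>.\<close>

lemma scaled_relators:
  assumes "x \<in> carrier A" "y \<in> carrier B"
  shows "x' \<in> carrier A \<Longrightarrow> Poly_Mapping.single (x \<oplus>\<^bsub>A\<^esub> x', y) d
      - Poly_Mapping.single (x, y) d - Poly_Mapping.single (x', y) d \<in> N" (is "_ \<Longrightarrow> ?a \<in> N")
    and "y' \<in> carrier B \<Longrightarrow> Poly_Mapping.single (x, y \<oplus>\<^bsub>B\<^esub> y') d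
      - Poly_Mapping.single (x, y) d - Poly_Mapping.single (x, y') d \<in> N" (is "_ \<Longrightarrow> ?b \<in> N")
    and "Poly_Mapping.single (c \<odot>\<^bsub>A\<^esub> x, y) d - Poly_Mapping.single (x, y) (c * d) \<in> N" (is "?c \<in> N")
    and "Poly_Mapping.single (x, c \<odot>\<^bsub>B\<^esub> y) d - Poly_Mapping.single (x, y) (c * d) \<in> N" (is "?d \<in> N")
proof -
  have *: "pscale d r \<in> N" if "r \<in> bilinear_relators A B" for r
    using that by (intro pscale.span_scale pscale.span_base)
  let ?e = "\<lambda>x y. Poly_Mapping.single (x, y) (1 :: 'a)"
  show "?a \<in> N" if "x' \<in> carrier A"
    using *[of "?e (x \<oplus>\<^bsub>A\<^esub> x') y - ?e x y - ?e x' y"] assms that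
    by (force simp: bilinear_relators_def Let_def pscale.scale_right_diff_distrib)
  show "?b \<in> N" if "y' \<in> carrier B"
    using *[of "?e x (y \<oplus>\<^bsub>B\<^esub> y') - ?e x y - ?e x y'"] assms that
    by (force simp: bilinear_relators_def Let_def pscale.scale_right_diff_distrib)
  show "?c \<in> N"
    using *[of "?e (c \<odot>\<^bsub>A\<^esub> x) y - pscale c (?e x y)"] assms
    by (force simp: bilinear_relators_def Let_def pscale.scale_right_diff_distrib mult_ac)
  show "?d \<in> N"
    using *[of "?e x (c \<odot>\<^bsub>B\<^esub> y) - pscale c (?e x y)"] assms
    by (force simp: bilinear_relators_def Let_def pscale.scale_right_diff_distrib mult_ac)
qed

text \<open>Scalars are moved into the coefficient of the monomial, the form in which products and
  linear maps on \<open>P\<close> can be evaluated directly.\<close>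

lemma relator_cases:
  assumes "b \<in> bilinear_relators A B"
  obtains x x' y where "x \<in> carrier A" "x' \<in> carrier A" "y \<in> carrier B"
      "b = Poly_Mapping.single (x \<oplus>\<^bsub>A\<^esub> x', y) 1 - Poly_Mapping.single (x, y) 1 - Poly_Mapping.single (x', y) 1"
  | x y y' where "x \<in> carrier A" "y \<in> carrier B" "y' \<in> carrier B"
      "b = Poly_Mapping.single (x, y \<oplus>\<^bsub>B\<^esub> y') 1 - Poly_Mapping.single (x, y) 1 - Poly_Mapping.single (x, y') 1"
  | c x y where "x \<in> carrier A" "y \<in> carrier B"
      "b = Poly_Mapping.single (c \<odot>\<^bsub>A\<^esub> x, y) 1 - Poly_Mapping.single (x, y) c"
  | c x y where "x \<in> carrier A" "y \<in> carrier B"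
      "b = Poly_Mapping.single (x, c \<odot>\<^bsub>B\<^esub> y) 1 - Poly_Mapping.single (x, y) c"
  using assms unfolding bilinear_relators_def Let_def pscale_single mult_1_right
  by (elim UnE CollectE exE conjE) metis+

text \<open>For a monomial \<open>p\<close>, distributivity and scalar compatibility in the two
  factors turn the product into one of the \<open>scaled_relators\<close>; sums are absorbed by the
  span.\<close>

lemma relator_mult:
  assumes "b \<in> bilinear_relators A B" "p \<in> carrier P"
  shows "p \<otimes>\<^bsub>P\<^esub> b \<in> N \<and> b \<otimes>\<^bsub>P\<^esub> p \<in> N"
  using assms(2)
proof (induction p rule: carrier_induct)
  case (single x y d)
  from assms(1) show ?case
    by (cases rule: relator_cases)
      (use single in \<open>simp_all add: pair_mult_diff_left pair_mult_diff_right A.r_distr A.l_distr B.r_distr B.l_distr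
        A.smult_mult_left A.smult_mult_right B.smult_mult_left B.smult_mult_right
        scaled_relators mult.commute[of d]\<close>)
next
  case (add p r)
  then show ?case
    unfolding pair_mult_add_left pair_mult_add_right by (blast intro: pscale.span_add)
qed

lemma algebra_ideal_span: "algebra_ideal P N"
proof -
  interpret P: unital_algebra P by (rule unital_algebra_pair)
  \<comment> \<open>For fixed \<open>p\<close>, the elements whose products with \<open>p\<close> on
    both sides lie in \<open>N\<close> form a subspace containing the relators, hence all of
    \<open>N\<close>. The carrier condition is included because \<open>pscale_mult\<close> requires
    it.\<close>
  have absorb: "b \<in> N \<Longrightarrow> b \<in> {b. b \<in> carrier P \<and> p \<otimes>\<^bsub>P\<^esub> b \<in> N \<and> b \<otimes>\<^bsub>P\<^esub> p \<in> N}"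
    if p: "p \<in> carrier P" for b p
  proof (rule subsetD[OF pscale.span_minimal])
    show "bilinear_relators A B \<subseteq> {b. b \<in> carrier P \<and> p \<otimes>\<^bsub>P\<^esub> b \<in> N \<and> b \<otimes>\<^bsub>P\<^esub> p \<in> N}"
      using relator_mult[OF _ p] relators_closed by blast
    have "p \<otimes>\<^bsub>P\<^esub> 0 = 0" "0 \<otimes>\<^bsub>P\<^esub> p = 0" using P.r_null[OF p] P.l_null[OF p] by simp_all
    then show "pscale.subspace {b. b \<in> carrier P \<and> p \<otimes>\<^bsub>P\<^esub> b \<in> N \<and> b \<otimes>\<^bsub>P\<^esub> p \<in> N}"
      using p by (intro pscale.subspaceI)
        (auto simp: pair_mult_add_left pair_mult_add_right pscale_mult pscale.span_zero
          simp del: pair_alg_simps(1) intro: pscale.span_add pscale.span_scale add_closed pscale_closed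
          P.zero_closed[unfolded pair_alg_simps(3)])
  qed
  have "subgroup N (add_monoid P)"
  proof (rule P.add.subgroupI)
    show "\<ominus>\<^bsub>P\<^esub> b \<in> N" if "b \<in> N" for b
    proof -
      have "\<ominus>\<^bsub>P\<^esub> b = - b"
        using that span_closed by (intro P.minus_equality) auto
      then show ?thesis using that by (simp add: pscale.span_neg)
    qed
    show "N \<noteq> {}" using pscale.span_zero by blast
  qed (use span_closed pscale.span_add in auto)
  then have "ideal N P"
    using absorb by (intro idealI P.ring_axioms) auto
  then show ?thesis using unital_algebra_pair by (intro algebra_ideal.intro)
qed

end

section \<open>Algebra homomorphisms\<close>

lemma alg_homD:
  assumes "h \<in> alg_hom A B" "x \<in> carrier A"
  shows "h x \<in> carrier B" "h (c \<odot>\<^bsub>A\<^esub> x) = c \<odot>\<^bsub>B\<^esub> h x" "h \<one>\<^bsub>A\<^esub> = \<one>\<^bsub>B\<^esub>"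
    and "y \<in> carrier A \<Longrightarrow> h (x \<oplus>\<^bsub>A\<^esub> y) = h x \<oplus>\<^bsub>B\<^esub> h y"
    and "y \<in> carrier A \<Longrightarrow> h (x \<otimes>\<^bsub>A\<^esub> y) = h x \<otimes>\<^bsub>B\<^esub> h y"
  using assms by (auto simp: alg_hom_def ring_hom_def)

lemma alg_hom_zero:
  assumes "unital_algebra A" "unital_algebra B" "h \<in> alg_hom A B"
  shows "h \<zero>\<^bsub>A\<^esub> = \<zero>\<^bsub>B\<^esub>"
proof -
  interpret A: unital_algebra A by fact
  interpret B: unital_algebra B by fact
  have "h (0 \<odot>\<^bsub>A\<^esub> \<zero>\<^bsub>A\<^esub>) = 0 \<odot>\<^bsub>B\<^esub> h \<zero>\<^bsub>A\<^esub>"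
    using alg_homD(2)[OF assms(3)] by simp
  then show ?thesis
    using alg_homD(1)[OF assms(3)] by (simp add: A.smult_zero_left B.smult_zero_left)
qed

lemma alg_hom_comp:
  assumes "f \<in> alg_hom A B" "g \<in> alg_hom B C"
  shows "(\<lambda>x. g (f x)) \<in> alg_hom A C"
  using assms by (simp add: alg_hom_def ring_hom_def Pi_iff)

text \<open>Serves the extensionality clause of \<open>gamma\<close>. The operations stay inside the
  carrier, so restriction does not disturb the homomorphism laws.\<close>

lemma alg_hom_restrict:
  assumes "unital_algebra A" "h \<in> alg_hom A B"
  shows "restrict h (carrier A) \<in> alg_hom A B"
proof -
  interpret unital_algebra A by fact
  show ?thesis
    using assms(2) by (simp add: alg_hom_def ring_hom_def Pi_iff)
qed

lemma alg_iso_inv: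
  fixes A (structure)
  assumes "unital_algebra A" "h \<in> alg_iso A B"
  shows "inv_into (carrier A) h \<in> alg_hom B A"
proof -
  interpret unital_algebra A by fact
  let ?i = "inv_into (carrier A) h"
  have h: "h \<in> alg_hom A B" and bij: "bij_betw h (carrier A) (carrier B)"
    using assms(2) by (auto simp: alg_iso_def)
  note hD = alg_homD[OF h]
  have i: "?i (h x) = x" if "x \<in> carrier A" for x
    using bij that by (simp add: bij_betw_def)
  have *: "\<exists>a\<in>carrier A. x = h a" if "x \<in> carrier B" for x
    using bij that by (auto simp: bij_betw_def)
  have "?i \<in> ring_hom B A"
  proof (rule ring_hom_memI)
    show "?i \<one>\<^bsub>B\<^esub> = \<one>"
      using i[OF one_closed] hD(3)[OF one_closed] by simp
    fix x assume x: "x \<in> carrier B"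
    show "?i x \<in> carrier A" using *[OF x] i by force
    fix y assume y: "y \<in> carrier B"
    from *[OF x] *[OF y] obtain a b where "a \<in> carrier A" "b \<in> carrier A" "x = h a" "y = h b"
      by blast
    then show "?i (x \<otimes>\<^bsub>B\<^esub> y) = ?i x \<otimes> ?i y" "?i (x \<oplus>\<^bsub>B\<^esub> y) = ?i x \<oplus> ?i y"
      by (simp_all add: i hD(4,5)[symmetric])
  qed
  moreover have "?i (c \<odot>\<^bsub>B\<^esub> x) = c \<odot> ?i x" if x: "x \<in> carrier B" for c x
  proof -
    obtain a where "a \<in> carrier A" "x = h a" using *[OF x] by blast
    then show ?thesis by (simp add: i hD(2)[symmetric])
  qed
  ultimately show ?thesis by (simp add: alg_hom_def)
qed

section \<open>Universal property of the tensor product\<close>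

context tensor_product
begin

lemma unital_algebra_tensor: "unital_algebra (tensor_alg A B)"
  using algebra_ideal.unital_algebra_quot[OF algebra_ideal_span] by (simp add: tensor_alg_def)

lemma tensor_proj_alg_hom: "(\<lambda>p. N +>\<^bsub>P\<^esub> p) \<in> alg_hom P (tensor_alg A B)"
  using algebra_ideal.proj_alg_hom[OF algebra_ideal_span] by (simp add: tensor_alg_def)

lemma pure_tensor_closed:
  "x \<in> carrier A \<Longrightarrow> y \<in> carrier B \<Longrightarrow> pure_tensor A B x y \<in> carrier (tensor_alg A B)"
  unfolding pure_tensor_def by (intro alg_homD(1)[OF tensor_proj_alg_hom] single_closed)

lemma tensor_hom_unique:
  assumes g: "g \<in> alg_hom (tensor_alg A B) C" and h: "h \<in> alg_hom (tensor_alg A B) C"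
    and eq: "\<And>x y. x \<in> carrier A \<Longrightarrow> y \<in> carrier B \<Longrightarrow> g (pure_tensor A B x y) = h (pure_tensor A B x y)"
    and X: "X \<in> carrier (tensor_alg A B)"
  shows "g X = h X"
proof -
  let ?\<pi> = "\<lambda>p. N +>\<^bsub>P\<^esub> p"
  note gp = alg_homD[OF alg_hom_comp[OF tensor_proj_alg_hom g]]
    and hp = alg_homD[OF alg_hom_comp[OF tensor_proj_alg_hom h]]
  obtain p where p: "p \<in> carrier P" "X = ?\<pi> p"
    using algebra_ideal.quot_cases[OF algebra_ideal_span] X by (metis tensor_alg_def)
  from p(1) have "g (?\<pi> p) = h (?\<pi> p)"
  proof (induction p rule: carrier_induct)
    \<comment> \<open>A monomial with coefficient c is c times one with coefficient 1, whose class
      is a pure tensor.\<close>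
    case (single x y c)
    then show ?case
      using gp(2)[OF single_closed, of x y c 1] hp(2)[OF single_closed, of x y c 1] eq[of x y]
      by (simp add: pure_tensor_def)
  next
    case (add p r)
    then show ?case using gp(4)[of p r] hp(4)[of p r] by simp
  qed
  with p show ?thesis by simp
qed

text \<open>The commutation hypothesis is what makes the induced linear map multiplicative: it lets
  g y pass f x' in f x f x' g y g y'.\<close>

lemma tensor_lift:
  assumes C: "unital_algebra C" and f: "f \<in> alg_hom A C" and g: "g \<in> alg_hom B C"
    and comm: "\<And>x y. x \<in> carrier A \<Longrightarrow> y \<in> carrier B \<Longrightarrow> f x \<otimes>\<^bsub>C\<^esub> g y = g y \<otimes>\<^bsub>C\<^esub> f x"
  obtains h where "h \<in> alg_hom (tensor_alg A B) C"
    "\<And>x y. x \<in> carrier A \<Longrightarrow> y \<in> carrier B \<Longrightarrow> h (pure_tensor A B x y) = f x \<otimes>\<^bsub>C\<^esub> g y"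
proof -
  interpret C: unital_algebra C by fact
  note fD [simp] = alg_homD[OF f] and gD [simp] = alg_homD[OF g]
  \<comment> \<open>\<open>L\<close> is the linear extension of (x, y) |-> f x g y to formal
    combinations, before passing to the quotient.\<close>
  define trm where "trm p u = Poly_Mapping.lookup p u \<odot>\<^bsub>C\<^esub> (f (fst u) \<otimes>\<^bsub>C\<^esub> g (snd u))" for p u
  define L where "L p = finsum C (trm p) (Poly_Mapping.keys p)" for p
  have trm_closed: "trm p \<in> S \<rightarrow> carrier C" if "S \<subseteq> carrier A \<times> carrier B" for p S
    using that by (auto simp: trm_def)
  \<comment> \<open>Sums over different supports become comparable once they are extended by zero
    terms to a common index set.\<close>
  have L_superset: "L p = finsum C (trm p) S"
    if "finite S" "Poly_Mapping.keys p \<subseteq> S" "S \<subseteq> carrier A \<times> carrier B" for p S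
    unfolding L_def using that
    by (intro C.add.finprod_mono_neutral_cong_left)
      (auto simp: in_keys_iff trm_def intro!: C.smult_zero_left)
  have L_single: "L (Poly_Mapping.single (x, y) c) = c \<odot>\<^bsub>C\<^esub> (f x \<otimes>\<^bsub>C\<^esub> g y)"
    if "x \<in> carrier A" "y \<in> carrier B" for x y c
    using that by (subst L_superset[of "{(x, y)}"]) (auto simp: trm_def)
  have L_add: "L (p + r) = L p \<oplus>\<^bsub>C\<^esub> L r" if "p \<in> carrier P" "r \<in> carrier P" for p r
  proof -
    let ?S = "Poly_Mapping.keys p \<union> Poly_Mapping.keys r"
    have S: "finite ?S" "?S \<subseteq> carrier A \<times> carrier B" using that by auto
    have "finsum C (trm (p + r)) ?S = finsum C (\<lambda>u. trm p u \<oplus>\<^bsub>C\<^esub> trm r u) ?S"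
      using S(2) by (intro C.add.finprod_cong')
        (auto simp: trm_def lookup_add intro!: C.smult_add_left)
    also have "\<dots> = finsum C (trm p) ?S \<oplus>\<^bsub>C\<^esub> finsum C (trm r) ?S"
      by (intro C.finsum_addf trm_closed S)
    finally show ?thesis
      using S keys_add[of p r] by (simp add: L_superset[of ?S])
  qed
  have L_closed: "L p \<in> carrier C" if "p \<in> carrier P" for p
    unfolding L_def using that by (intro C.finsum_closed trm_closed) simp
  have L_scale: "L (pscale c p) = c \<odot>\<^bsub>C\<^esub> L p" if "p \<in> carrier P" for c p
    using that
  proof (induction p rule: carrier_induct)
    case (single x y d)
    then show ?case by (simp add: L_single C.smult_smult)
  next
    case (add p r)
    then show ?case
      by (simp add: pscale.scale_right_distrib L_add pscale_closed L_closed C.smult_add_right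
          del: pair_alg_simps(1))
  qed
  have L_mult: "L (p \<otimes>\<^bsub>P\<^esub> r) = L p \<otimes>\<^bsub>C\<^esub> L r" if p: "p \<in> carrier P" and r: "r \<in> carrier P" for p r
    using p
  proof (induction p rule: carrier_induct)
    case p: (single x y c)
    from r show ?case
    proof (induction r rule: carrier_induct)
      case r: (single x' y' d)
      have "f x \<otimes>\<^bsub>C\<^esub> f x' \<otimes>\<^bsub>C\<^esub> (g y \<otimes>\<^bsub>C\<^esub> g y') = f x \<otimes>\<^bsub>C\<^esub> (f x' \<otimes>\<^bsub>C\<^esub> g y) \<otimes>\<^bsub>C\<^esub> g y'"
        using p r by (simp add: C.m_assoc)
      also have "\<dots> = f x \<otimes>\<^bsub>C\<^esub> g y \<otimes>\<^bsub>C\<^esub> (f x' \<otimes>\<^bsub>C\<^esub> g y')"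
        using p r comm[of x' y] by (simp add: C.m_assoc)
      finally show ?case
        using p r by (simp add: L_single C.smult_mult_left C.smult_mult_right C.smult_smult
            mult.commute)
    next
      case (add r s)
      then show ?case
        using p by (simp add: pair_mult_add_right L_add L_closed mult_closed single_closed C.r_distr
            del: pair_alg_simps(1))
    qed
  next
    case (add p s)
    then show ?case
      using r by (simp add: pair_mult_add_left L_add L_closed mult_closed C.l_distr
          del: pair_alg_simps(1))
  qed
  have "f \<one>\<^bsub>A\<^esub> = \<one>\<^bsub>C\<^esub>" "g \<one>\<^bsub>B\<^esub> = \<one>\<^bsub>C\<^esub>" 
    by (rule fD(3)[OF A.one_closed], rule gD(3)[OF B.one_closed])
  then have L_hom: "L \<in> alg_hom P C"
    unfolding alg_hom_def
    by (auto intro!: ring_hom_memI simp del: pair_alg_simps(1)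
        simp: L_closed L_mult L_add L_scale L_single C.smult_one)
  have "L b = \<zero>\<^bsub>C\<^esub>" if "b \<in> N" for b
  proof -
    have diff: "p - r \<in> carrier P \<and> L (p - r) = L p \<ominus>\<^bsub>C\<^esub> L r" if "p \<in> carrier P" "r \<in> carrier P" for p r
    proof -
      have "p - r = p + pscale (- 1) r" by simp
      with that show ?thesis
        by (simp only: add_closed L_add pscale_closed L_scale L_closed C.smult_minus_one C.minus_eq simp_thms)
    qed
    \<comment> \<open>This is the shape that \<open>L\<close> gives to the two additivity
      relators.\<close>
    have cancel: "a \<oplus>\<^bsub>C\<^esub> b \<ominus>\<^bsub>C\<^esub> a \<ominus>\<^bsub>C\<^esub> b = \<zero>\<^bsub>C\<^esub>" if "a \<in> carrier C" "b \<in> carrier C" for a b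
      using that C.r_neg[of "a \<oplus>\<^bsub>C\<^esub> b"] by (simp add: C.minus_eq C.minus_add C.a_assoc)
    have "L b = \<zero>\<^bsub>C\<^esub>" if "b \<in> bilinear_relators A B" for b
      using that
      by (cases rule: relator_cases)
        (simp_all add: diff single_closed L_single C.l_distr C.r_distr C.smult_one
          C.smult_mult_left C.smult_mult_right cancel del: pair_alg_simps(1))
    then have "N \<subseteq> {b. b \<in> carrier P \<and> L b = \<zero>\<^bsub>C\<^esub>}"
      \<comment> \<open>The zero of \<open>P\<close> is the monomial at the pair of zeros with
        coefficient 0; this yields its membership in the carrier and
        \<open>L 0 = \<zero>\<close>.\<close>
      using relators_closed L_single[of "\<zero>\<^bsub>A\<^esub>" "\<zero>\<^bsub>B\<^esub>" 0] single_closed[of "\<zero>\<^bsub>A\<^esub>" "\<zero>\<^bsub>B\<^esub>" 0]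
      by (intro pscale.span_minimal pscale.subspaceI)
        (auto simp: L_add L_scale C.smult_zero_right C.smult_zero_left simp del: pair_alg_simps(1)
          intro: add_closed pscale_closed)
    with that show ?thesis by blast
  qed
  then obtain h where "h \<in> alg_hom (tensor_alg A B) C" "\<And>p. p \<in> carrier P \<Longrightarrow> h (N +>\<^bsub>P\<^esub> p) = L p"
    using algebra_ideal.quot_lift[OF algebra_ideal_span C L_hom] unfolding tensor_alg_def by metis
  then show thesis
    by (intro that[of h]) (simp_all add: pure_tensor_def single_closed L_single C.smult_one
        del: pair_alg_simps(1))
qed

end

section \<open>The projection onto the q-Onsager algebra\<close>

text \<open>The description in \<open>gamma\<close> must be shown to have exactly one solution;
  \<open>theI'\<close> then hands its clauses to \<open>gamma\<close>.\<close>

lemma gamma_alg_hom: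
  assumes "is_phi q \<phi>"
  shows "gamma q \<phi> \<in> alg_hom (calOq q) (Oq q)"
proof -
  interpret O: unital_algebra "Oq q"
    unfolding Oq_def by (rule unital_algebra_presented)
  interpret T: tensor_product "Oq q" "monoid_alg :: ('a, 'a zpoly) module"
    by (intro tensor_product.intro O.unital_algebra_axioms unital_algebra_monoid_alg)
  have phi: "\<phi> \<in> alg_iso (OqZ q) (calOq q)" using assms by (simp add: is_phi_def)
  then have phi_hom: "\<phi> \<in> alg_hom (OqZ q) (calOq q)" and bij: "bij_betw \<phi> (carrier (OqZ q)) (carrier (calOq q))"
    by (auto simp: alg_iso_def)
  let ?P = "\<lambda>g. g \<in> alg_hom (calOq q) (Oq q) \<and> g \<in> extensional (carrier (calOq q))
   \<and> (\<forall>x\<in>carrier (Oq q). \<forall>f. g (\<phi> (OqZ_pure q x f)) = theta f \<odot>\<^bsub>Oq q\<^esub> x)"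
  have id: "(\<lambda>x. x) \<in> alg_hom (Oq q) (Oq q)"
    by (auto simp: alg_hom_def ring_hom_def)
  \<comment> \<open>\<open>theta\<close> takes values in the field; multiplying by the unit turns it
    into a homomorphism to \<open>Oq q\<close>.\<close>
  have th: "(\<lambda>f. theta f \<odot>\<^bsub>Oq q\<^esub> \<one>\<^bsub>Oq q\<^esub>) \<in> alg_hom monoid_alg (Oq q)"
    unfolding alg_hom_def
    by (auto intro!: ring_hom_memI simp: theta_hom O.smult_add_left O.smult_smult O.smult_one
        O.smult_mult_left O.smult_mult_right mult.commute)
  obtain e where e: "e \<in> alg_hom (OqZ q) (Oq q)"
    "\<And>x f. x \<in> carrier (Oq q) \<Longrightarrow> e (OqZ_pure q x f) = theta f \<odot>\<^bsub>Oq q\<^esub> x"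
  proof (rule T.tensor_lift[OF O.unital_algebra_axioms id th])
    fix h assume "h \<in> alg_hom (tensor_alg (Oq q) monoid_alg) (Oq q)"
      "\<And>x y. x \<in> carrier (Oq q) \<Longrightarrow> y \<in> carrier monoid_alg \<Longrightarrow>
         h (pure_tensor (Oq q) monoid_alg x y) = x \<otimes>\<^bsub>Oq q\<^esub> (theta y \<odot>\<^bsub>Oq q\<^esub> \<one>\<^bsub>Oq q\<^esub>)"
    then show thesis
      by (intro that[of h]) (simp_all add: OqZ_def OqZ_pure_def O.smult_mult_right)
  qed (simp_all add: O.smult_mult_left O.smult_mult_right)
  have pure_closed: "OqZ_pure q x f \<in> carrier (OqZ q)" if "x \<in> carrier (Oq q)" for x f
    using T.pure_tensor_closed[OF that] by (simp add: OqZ_pure_def OqZ_def)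
  have OqZ_alg: "unital_algebra (OqZ q)" unfolding OqZ_def by (rule T.unital_algebra_tensor)
  have calOq_alg: "unital_algebra (calOq q)" unfolding calOq_def by (rule unital_algebra_presented)
  define g where "g = restrict (\<lambda>y. e (inv_into (carrier (OqZ q)) \<phi> y)) (carrier (calOq q))"
  have "g \<in> alg_hom (calOq q) (Oq q)"
    unfolding g_def
    by (intro alg_hom_restrict calOq_alg alg_hom_comp[OF alg_iso_inv[OF OqZ_alg phi] e(1)])
  moreover have "g (\<phi> (OqZ_pure q x f)) = theta f \<odot>\<^bsub>Oq q\<^esub> x" if "x \<in> carrier (Oq q)" for x f
    using bij pure_closed[OF that] e(2)[OF that] alg_homD(1)[OF phi_hom]
    by (simp add: g_def bij_betw_def)
  ultimately have "?P g" by (simp add: g_def)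
  moreover have "g' = g''" if g': "?P g'" and g'': "?P g''" for g' g''
  proof (rule extensionalityI)
    show "g' \<in> extensional (carrier (calOq q))" "g'' \<in> extensional (carrier (calOq q))"
      using g' g'' by auto
    fix y assume "y \<in> carrier (calOq q)"
    \<comment> \<open>By surjectivity of \<open>\<phi>\<close>, two solutions can be compared after
      composition with \<open>\<phi>\<close>, as homomorphisms on the tensor product that agree on
      pure tensors.\<close>
    then obtain X where X: "X \<in> carrier (OqZ q)" "y = \<phi> X" using bij by (auto simp: bij_betw_def)
    have hom: "(\<lambda>X. k (\<phi> X)) \<in> alg_hom (tensor_alg (Oq q) monoid_alg) (Oq q)"
      if "?P k" for k
      using alg_hom_comp[OF phi_hom conjunct1[OF that]] by (simp add: OqZ_def)
    have val: "k (\<phi> (pure_tensor (Oq q) monoid_alg x f)) = theta f \<odot>\<^bsub>Oq q\<^esub> x"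
      if "?P k" "x \<in> carrier (Oq q)" for k x f
      using that by (simp add: OqZ_pure_def)
    have "g' (\<phi> X) = g'' (\<phi> X)"
    proof (rule T.tensor_hom_unique[OF hom[OF g'] hom[OF g'']])
      show "X \<in> carrier (tensor_alg (Oq q) monoid_alg)" using X(1) by (simp add: OqZ_def)
    qed (simp add: val[OF g'] val[OF g''])
    with X show "g' y = g'' y" by simp
  qed
  ultimately have "\<exists>!g. ?P g" by blast
  then have "?P (gamma q \<phi>)" unfolding gamma_def by (rule theI')
  then show ?thesis by blast
qed

section \<open>Evaluating commutators under a homomorphism out of a free algebra\<close>

context
  fixes C :: "('a::field, 'b) module" (structure) and h :: "('x list \<Rightarrow>\<^sub>0 'a) \<Rightarrow> 'b"
  assumes C: "unital_algebra C" and h: "h \<in> alg_hom monoid_alg C"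
begin

interpretation unital_algebra C by (rule C)

lemma free_hom_closed: "h x \<in> carrier C"
  using alg_homD(1)[OF h] by simp

lemma free_hom_add: "h (x + y) = h x \<oplus> h y"
  using alg_homD(4)[OF h] by simp

lemma free_hom_mult: "h (x * y) = h x \<otimes> h y"
  using alg_homD(5)[OF h] by simp

lemma free_hom_scale: "h (pscale c x) = c \<odot> h x"
  using alg_homD(2)[OF h] by simp

lemma free_hom_diff: "h (x - y) = h x \<ominus> h y"
  using free_hom_add[of "x - y" y] free_hom_closed by (simp add: minus_eq a_assoc r_neg)

lemma free_hom_comm: "h (comm x y) = commutator C (h x) (h y)"
  by (simp add: comm_def commutator_def free_hom_diff free_hom_mult)

lemma free_hom_rcomm: "h (rcomm r x y) = r_commutator C r (h x) (h y)"
  by (simp add: rcomm_def r_commutator_def free_hom_diff free_hom_mult free_hom_scale)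

end

theorem theorem11p6:
  fixes q :: "'a::field"
    and \<phi> :: "(((onsager_gen list \<Rightarrow>\<^sub>0 'a) set \<times> 'a zpoly) \<Rightarrow>\<^sub>0 'a) set \<Rightarrow> (alt_gen list \<Rightarrow>\<^sub>0 'a) set"
    and W V G H :: "nat \<Rightarrow> (onsager_gen list \<Rightarrow>\<^sub>0 'a) set"
    and A (structure)
  assumes q_nonzero: "q \<noteq> 0"
    and q_not_root_of_unity: "\<And>n::nat. n > 0 \<Longrightarrow> q ^ n \<noteq> 1"
    and phi: "is_phi q \<phi>"
    and A: "A = Oq q"
    and W: "\<And>k. W k = gamma q \<phi> (calOq_gen q (Wm k))"
    and V: "\<And>k. V k = gamma q \<phi> (calOq_gen q (Wp k))"
    and G: "\<And>k. G k = gamma q \<phi> (calOq_gen q (GG k))"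
    and H: "\<And>k. H k = gamma q \<phi> (calOq_gen q (GT k))"
  shows "\<forall>k l.
      commutator A (W 0) (V k) = inverse (q + inverse q) \<odot> (H k \<ominus> G k)
    \<and> commutator A (W k) (V 0) = inverse (q + inverse q) \<odot> (H k \<ominus> G k)
    \<and> r_commutator A q (W 0) (G k) = (rho q \<odot> W (k + 1)) \<ominus> (rho q \<odot> V k)
    \<and> r_commutator A q (H k) (W 0) = (rho q \<odot> W (k + 1)) \<ominus> (rho q \<odot> V k)
    \<and> r_commutator A q (G k) (V 0) = (rho q \<odot> V (k + 1)) \<ominus> (rho q \<odot> W k)
    \<and> r_commutator A q (V 0) (H k) = (rho q \<odot> V (k + 1)) \<ominus> (rho q \<odot> W k)
    \<and> commutator A (W k) (W l) = \<zero>
    \<and> commutator A (V k) (V l) = \<zero>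
    \<and> commutator A (W k) (V l) \<oplus> commutator A (V k) (W l) = \<zero>
    \<and> commutator A (W k) (G l) \<oplus> commutator A (G k) (W l) = \<zero>
    \<and> commutator A (W k) (H l) \<oplus> commutator A (H k) (W l) = \<zero>
    \<and> commutator A (V k) (G l) \<oplus> commutator A (G k) (V l) = \<zero>
    \<and> commutator A (V k) (H l) \<oplus> commutator A (H k) (V l) = \<zero>
    \<and> commutator A (G k) (G l) = \<zero>
    \<and> commutator A (H k) (H l) = \<zero>
    \<and> commutator A (H k) (G l) \<oplus> commutator A (G k) (H l) = \<zero>"
proof -
  \<comment> \<open>Working from the free algebra allows the relators to be evaluated as written,
    without computing with cosets.\<close>
  define h where "h p = gamma q \<phi> (presented_class (alt_relators q) p)" for p
  have A_alg: "unital_algebra A" unfolding A Oq_def by (rule unital_algebra_presented)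
  interpret A: unital_algebra A by (rule A_alg)
  have cal_alg: "unital_algebra (calOq q)" unfolding calOq_def by (rule unital_algebra_presented)
  have cal_hom: "presented_class (alt_relators q) \<in> alg_hom monoid_alg (calOq q)"
    unfolding calOq_def by (rule presented_class_alg_hom)
  have gamma: "gamma q \<phi> \<in> alg_hom (calOq q) A" unfolding A by (rule gamma_alg_hom[OF phi])
  have h: "h \<in> alg_hom monoid_alg A" unfolding h_def[abs_def] by (rule alg_hom_comp[OF cal_hom gamma])
  note free = free_hom_add[OF A_alg h] free_hom_diff[OF A_alg h] free_hom_comm[OF A_alg h]
    free_hom_rcomm[OF A_alg h] free_hom_scale[OF A_alg h]
  have gens: "h (gen (Wm k)) = W k" "h (gen (Wp k)) = V k" "h (gen (GG k)) = G k" "h (gen (GT k)) = H k" for k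
    by (simp_all add: h_def W V G H calOq_gen_def calOq_class_def)
  have closed [simp]: "W k \<in> carrier A" "V k \<in> carrier A" "G k \<in> carrier A" "H k \<in> carrier A" for k
    using free_hom_closed[OF A_alg h] by (simp_all add: gens[symmetric])
  \<comment> \<open>A relator has class zero in \<open>calOq q\<close>, and \<open>gamma\<close>
    preserves zero.\<close>
  have "h r = \<zero>" if "r \<in> alt_relators q" for r
    using presented_class_relator[OF that] alg_hom_zero[OF cal_alg A_alg gamma]
    by (simp add: h_def calOq_def)
  then have "\<forall>r\<in>alt_relators q. h r = \<zero>" by blast
  \<comment> \<open>A relator that is a difference becomes
    \<open>h u \<ominus> h v = \<zero>\<close>, which is an equality once both terms are known to
    lie in the carrier. Unfolding the commutators reduces this to \<open>closed\<close>.\<close>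
  then show ?thesis
    unfolding alt_relators_def Let_def
    by (simp add: ball_Un free gens commutator_def r_commutator_def)
qed

end
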